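(* Let $\chi\in(0,1)$, let $d$ be a positive integer, let $\{\bar A_k\}_{k=1}^\infty$ be a sequence of symmetric, positive semidefinite matrices in $\mathbb R^{d\times d}$, let $\{\bar b_k\}_{k=1}^\infty$ be a sequence in $\mathbb R^d$, and let $\{\bar h_k\}_{k=1}^\infty$ be a sequence in $\mathbb R^d$ satisfying $$\bar h_{k+1}=\bar h_k+\frac1{k^\chi}\left(\bar b_k-\bar A_k\bar h_k\right)\qquad\text{for all }k=1,2,\dots$$ Suppose $\gamma\in[0,\chi)$, $A\in\mathbb R^{d\times d}$ is a symmetric positive-definite matrix, $b\in\mathbb R^d$, $h=A^{-1}b$, and $$\frac1{n^{\chi-\gamma}}\sum_{k=1}^n(\bar b_k-b)\to0\quad\text{and}\quad\frac1{n^{\chi-\gamma}}\sum_{k=1}^n(\bar A_k-A)\to0\qquad\text{as }n\to\infty.$$ Then $|\bar h_n-h|=o(n^{-\gamma})$ as $n\to\infty$.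
   Context: All sequences are deterministic. $|x|$ denotes the Euclidean norm of $x\in\mathbb R^d$. *)

theory Defs
  imports "HOL-Analysis.Analysis" "HOL-Library.Landau_Symbols"
begin

definition symmetric_matrix :: "real ^ 'd ^ 'd \<Rightarrow> bool" where
  "symmetric_matrix A \<longleftrightarrow> transpose A = A"

text \<open>Symmetry is not part of the following two notions.\<close>

definition positive_semidefinite :: "real ^ 'd ^ 'd \<Rightarrow> bool" where
  "positive_semidefinite A \<longleftrightarrow> (\<forall>x. 0 \<le> x \<bullet> (A *v x))"

definition positive_definite :: "real ^ 'd ^ 'd \<Rightarrow> bool" where
  "positive_definite A \<longleftrightarrow> (\<forall>x. x \<noteq> 0 \<longrightarrow> 0 < x \<bullet> (A *v x))"

end

theory Submission
  imports Defs "HOL-Real_Asymp.Real_Asymp"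
begin

text \<open>
  The error \<open>e k = hbar k - h\<close> satisfies \<open>e (k + 1) = (I - B k) e k + k powr (- chi) \<xi> k\<close> with
  \<open>B k = k powr (- chi) Abar k\<close> and \<open>\<xi> k = (bbar k - b) - (Abar k - A) h\<close>, and the partial sums of
  \<open>\<xi>\<close> are \<open>o(n powr (chi - \<gamma>))\<close>. Split time into blocks that start at \<open>n\<close> and have length about
  \<open>n powr chi\<close>. Over a block the sum of the \<open>B k\<close> is close to a matrix comparable to \<open>A\<close>, and since
  \<open>0 \<le> B k \<le> I\<close>, the product of the \<open>I - B k\<close> contracts by a factor that does not depend on the
  block. By summation by parts the noise collected in a block is \<open>o(n powr (- \<gamma>))\<close>. As consecutive
  block starts have ratio tending to 1, \<open>n powr \<gamma> |e n|\<close> is contracted from block to block up to a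
  vanishing error.
\<close>

section \<open>Matrix-vector products, traces and the Frobenius norm\<close>

lemma symmetric_matrix_inner:
  assumes "symmetric_matrix B"
  shows "x \<bullet> (B *v y) = y \<bullet> (B *v x)"
proof -
  have "x \<bullet> (B *v y) = (x v* B) \<bullet> y"
    by (simp add: dot_lmul_matrix)
  also have "x v* B = B *v x"
    using assms unfolding symmetric_matrix_def by (metis matrix_transpose_mul transpose_matrix_vector)
  finally show ?thesis by (simp add: inner_commute)
qed

lemma sum_matrix_vector_mult:
  "(\<Sum>k\<in>I. B k) *v x = (\<Sum>k\<in>I. B k *v (x :: real ^ 'n))"
  by (induction I rule: infinite_finite_induct) (simp_all add: matrix_vector_mult_add_rdistrib)

lemma trace_sum: "trace (\<Sum>k\<in>I. B k :: real ^ 'n ^ 'n) = (\<Sum>k\<in>I. trace (B k))"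
  by (induction I rule: infinite_finite_induct) (simp_all add: trace_add, simp_all add: trace_def)

lemma trace_scaleR: "trace (c *\<^sub>R B) = c * trace (B :: real ^ 'n ^ 'n)"
  by (simp add: trace_def sum_distrib_left)

lemma abs_trace_le: "\<bar>trace (B :: real ^ 'n ^ 'n)\<bar> \<le> real CARD('n) * norm B"
proof -
  have "\<bar>trace B\<bar> \<le> (\<Sum>i\<in>UNIV. \<bar>B $ i $ i\<bar>)"
    unfolding trace_def by (rule sum_abs)
  also have "\<dots> \<le> (\<Sum>i\<in>(UNIV :: 'n set). norm B)"
  proof (rule sum_mono)
    fix i
    have "\<bar>B $ i $ i\<bar> \<le> norm (B $ i)" by (rule component_le_norm_cart)
    also have "\<dots> \<le> norm B" by (rule Finite_Cartesian_Product.norm_nth_le)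
    finally show "\<bar>B $ i $ i\<bar> \<le> norm B" .
  qed
  finally show ?thesis by simp
qed

text \<open>The \<open>norm\<close> of a matrix is the Frobenius norm, the L2 norm of the row norms,
  so Cauchy-Schwarz in each row is enough.\<close>

lemma norm_matrix_vector_mult_le:
  "norm (B *v x) \<le> norm (B :: real ^ 'n ^ 'm) * norm x"
proof -
  have "norm (B *v x) = L2_set (\<lambda>i. \<bar>(B $ i) \<bullet> x\<bar>) UNIV"
    by (simp add: norm_vec_def matrix_mult_dot)
  also have "\<dots> \<le> L2_set (\<lambda>i. norm (B $ i) * norm x) UNIV"
    by (intro L2_set_mono) (auto simp: Cauchy_Schwarz_ineq2)
  also have "\<dots> = norm B * norm x"
    by (simp add: L2_set_left_distrib norm_vec_def)
  finally show ?thesis .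
qed

lemma abs_inner_matrix_vector_le:
  "\<bar>x \<bullet> (B *v x)\<bar> \<le> norm (B :: real ^ 'n ^ 'n) * (norm x)\<^sup>2"
proof -
  have "\<bar>x \<bullet> (B *v x)\<bar> \<le> norm x * norm (B *v x)"
    by (rule Cauchy_Schwarz_ineq2)
  also have "\<dots> \<le> norm x * (norm B * norm x)"
    by (intro mult_left_mono norm_matrix_vector_mult_le) simp
  finally show ?thesis by (simp add: power2_eq_square mult_ac)
qed

section \<open>Quadratic forms of positive semidefinite and positive definite matrices\<close>

lemma discriminant_le:
  fixes p c r :: real
  assumes "\<And>t. 0 \<le> p + 2 * t * c + t\<^sup>2 * r" and "0 \<le> r"
  shows "c\<^sup>2 \<le> p * r"
proof (cases "r = 0")
  case True
  have "c = 0"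
  proof (rule ccontr)
    assume "c \<noteq> 0"
    \<comment> \<open>With \<open>r = 0\<close> the polynomial is affine in \<open>t\<close>, and at
      this point its value is -1.\<close>
    then show False using assms(1)[of "-(p + 1) / (2 * c)"] True by (simp add: field_simps)
  qed
  then show ?thesis using True by simp
next
  case False
  \<comment> \<open>The point \<open>- c / r\<close> minimises the quadratic.\<close>
  then show ?thesis using assms(1)[of "- c / r"] assms(2)
    by (simp add: field_simps power2_eq_square)
qed

lemma psd_Cauchy_Schwarz:
  assumes "symmetric_matrix B" "positive_semidefinite B"
  shows "(y \<bullet> (B *v x))\<^sup>2 \<le> (x \<bullet> (B *v x)) * (y \<bullet> (B *v y))"
proof (rule discriminant_le)
  fix t :: real
  have "0 \<le> (x + t *\<^sub>R y) \<bullet> (B *v (x + t *\<^sub>R y))"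
    using assms(2) by (auto simp: positive_semidefinite_def)
  also have "\<dots> = x \<bullet> (B *v x) + 2 * t * (y \<bullet> (B *v x)) + t\<^sup>2 * (y \<bullet> (B *v y))"
    using symmetric_matrix_inner[OF assms(1), of x y]
    by (simp add: matrix_vector_right_distrib matrix_vector_mult_scaleR inner_add_left
        inner_add_right power2_eq_square algebra_simps)
  finally show "0 \<le> x \<bullet> (B *v x) + 2 * t * (y \<bullet> (B *v x)) + t\<^sup>2 * (y \<bullet> (B *v y))" .
qed (use assms(2) in \<open>auto simp: positive_semidefinite_def\<close>)

lemma trace_nonneg:
  assumes "positive_semidefinite B"
  shows "0 \<le> trace B"
proof -
  have "0 \<le> B $ i $ i" for i
    using assms[unfolded positive_semidefinite_def, rule_format, of "axis i 1"]
    by (simp add: inner_axis' matrix_vector_mult_basis column_def)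
  then show ?thesis by (simp add: trace_def sum_nonneg)
qed

text \<open>Cauchy-Schwarz against \<open>axis i 1\<close> bounds the square of the
  \<open>i\<close>-th coordinate by the form at \<open>x\<close> times \<open>B $ i $ i\<close>, and
  summing over \<open>i\<close> produces the trace. The trace stands in for the largest eigenvalue:
  being linear in \<open>B\<close>, it can be summed over a block.\<close>

lemma norm_psd_mult_sq_le:
  assumes "symmetric_matrix B" "positive_semidefinite B"
  shows "(norm (B *v x))\<^sup>2 \<le> trace B * (x \<bullet> (B *v x))"
proof -
  have "((B *v x) $ i)\<^sup>2 \<le> (x \<bullet> (B *v x)) * B $ i $ i" for i
    using psd_Cauchy_Schwarz[OF assms, of "axis i 1" x]
    by (simp add: inner_axis' matrix_vector_mult_basis column_def)
  then have "(\<Sum>i\<in>UNIV. ((B *v x) $ i)\<^sup>2) \<le> (\<Sum>i\<in>UNIV. (x \<bullet> (B *v x)) * B $ i $ i)"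
    by (intro sum_mono)
  then show ?thesis
    by (simp add: norm_vec_def L2_set_def sum_nonneg trace_def sum_distrib_left mult.commute)
qed

lemma norm_psd_mult_le:
  assumes "symmetric_matrix B" "positive_semidefinite B"
  shows "norm (B *v x) \<le> trace B * norm x"
proof (cases "B *v x = 0")
  case True
  then show ?thesis using trace_nonneg[OF assms(2)] by simp
next
  case False
  have "(norm (B *v x))\<^sup>2 \<le> trace B * (x \<bullet> (B *v x))"
    by (rule norm_psd_mult_sq_le[OF assms])
  also have "\<dots> \<le> trace B * (norm x * norm (B *v x))"
    by (intro mult_left_mono norm_cauchy_schwarz trace_nonneg assms)
  finally show ?thesis using False by (simp add: power2_eq_square)
qed

lemma psd_form_le:
  assumes "symmetric_matrix B" "positive_semidefinite B"
  shows "x \<bullet> (B *v x) \<le> trace B * (norm x)\<^sup>2"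
proof -
  have "x \<bullet> (B *v x) \<le> norm x * norm (B *v x)"
    by (rule norm_cauchy_schwarz)
  also have "\<dots> \<le> norm x * (trace B * norm x)"
    by (intro mult_left_mono norm_psd_mult_le assms) simp
  finally show ?thesis by (simp add: power2_eq_square mult_ac)
qed

text \<open>By the parallelogram identity the right side minus the left side is the form at
  \<open>u - v\<close>.\<close>

lemma psd_form_add_le:
  assumes "positive_semidefinite B"
  shows "(u + v) \<bullet> (B *v (u + v)) \<le> 2 * (u \<bullet> (B *v u)) + 2 * (v \<bullet> (B *v v))"
proof -
  have "0 \<le> (u - v) \<bullet> (B *v (u - v))"
    using assms by (auto simp: positive_semidefinite_def)
  then show ?thesis
    by (simp add: matrix_vector_right_distrib matrix_vector_mult_diff_distrib
        inner_add_left inner_add_right inner_diff_left inner_diff_right)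
qed

text \<open>Expanding the square gives \<open>- 2 * (x \<bullet> (B *v x))\<close> plus the square
  of \<open>norm (B *v x)\<close>, and the trace bound lets the latter consume only one of the two
  copies. What is left is the energy lost in one step.\<close>

lemma norm_diff_psd_mult_sq_le:
  assumes "symmetric_matrix B" "positive_semidefinite B" "trace B \<le> 1"
  shows "(norm (x - B *v x))\<^sup>2 \<le> (norm x)\<^sup>2 - x \<bullet> (B *v x)"
proof -
  have "trace B * (x \<bullet> (B *v x)) \<le> 1 * (x \<bullet> (B *v x))"
    using assms by (intro mult_right_mono) (auto simp: positive_semidefinite_def)
  then have "(norm (B *v x))\<^sup>2 \<le> x \<bullet> (B *v x)"
    using norm_psd_mult_sq_le[OF assms(1,2), of x] by linarith
  then show ?thesis
    unfolding power2_norm_eq_inner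
    by (simp add: inner_diff_left inner_diff_right inner_commute)
qed

lemma norm_diff_psd_mult_le:
  assumes "symmetric_matrix B" "positive_semidefinite B" "trace B \<le> 1"
  shows "norm (x - B *v x) \<le> norm x"
proof -
  have "(norm (x - B *v x))\<^sup>2 \<le> (norm x)\<^sup>2"
    using norm_diff_psd_mult_sq_le[OF assms, of x] assms(2)
    unfolding positive_semidefinite_def by (smt (verit))
  then show ?thesis by (simp add: power2_le_iff_abs_le)
qed

text \<open>The constant is the minimum of the form on the unit sphere, attained by compactness;
  homogeneity extends the bound to all \<open>x\<close>.\<close>

lemma positive_definite_coercive:
  assumes "positive_definite A"
  obtains l where "0 < l" "\<And>x. l * (norm x)\<^sup>2 \<le> x \<bullet> (A *v x)"
proof -
  let ?f = "\<lambda>x. x \<bullet> (A *v x)"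
  have "compact (sphere 0 1 :: (real ^ 'a) set)" "sphere 0 1 \<noteq> ({} :: (real ^ 'a) set)"
    by auto
  moreover have "continuous_on (sphere 0 1) ?f"
    by (intro continuous_intros linear_continuous_on) (simp add: matrix_vector_mul_bounded_linear)
  ultimately obtain u where u: "norm u = 1" "\<And>y. norm y = 1 \<Longrightarrow> ?f u \<le> ?f y"
    using continuous_attains_inf[of "sphere 0 1" ?f] by (auto simp: dist_norm)
  show ?thesis
  proof (rule that)
    show "0 < ?f u" using u(1) assms unfolding positive_definite_def by (metis norm_zero zero_neq_one)
    fix x :: "real ^ 'a"
    show "?f u * (norm x)\<^sup>2 \<le> ?f x"
    proof (cases "x = 0")
      case False
      then have "?f u \<le> ?f ((1 / norm x) *\<^sub>R x)" by (intro u(2)) simp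
      also have "\<dots> = ?f x / (norm x)\<^sup>2"
        by (simp add: matrix_vector_mult_scaleR power2_eq_square)
      finally show ?thesis using False by (simp add: field_simps)
    qed simp
  qed
qed

section \<open>Summation by parts\<close>

lemma abel_sum_eq:
  fixes f :: "nat \<Rightarrow> 'a :: real_vector" and a :: "nat \<Rightarrow> real"
  shows "(\<Sum>k<Suc n. a k *\<^sub>R f k) =
    a n *\<^sub>R (\<Sum>k<Suc n. f k) + (\<Sum>k<n. (a k - a (Suc k)) *\<^sub>R (\<Sum>j<Suc k. f j))"
  by (induction n) (simp_all add: algebra_simps)

text \<open>After summation by parts the coefficients \<open>a m\<close> and
  \<open>a k - a (Suc k)\<close> of the partial sums are nonnegative and telescope to
  \<open>a 0\<close>.\<close>

lemma norm_abel_sum_le: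
  fixes f :: "nat \<Rightarrow> 'a :: real_normed_vector" and a :: "nat \<Rightarrow> real"
  assumes "\<And>k. 0 \<le> a k" "\<And>k. a (Suc k) \<le> a k"
    and "\<And>k. k \<le> N \<Longrightarrow> norm (\<Sum>j<k. f j) \<le> M" "n \<le> N"
  shows "norm (\<Sum>k<n. a k *\<^sub>R f k) \<le> a 0 * M"
proof (cases n)
  case 0
  have "0 \<le> M" using assms(3)[of 0] by simp
  then show ?thesis using 0 assms(1)[of 0] by simp
next
  case (Suc m)
  have "norm (\<Sum>k<n. a k *\<^sub>R f k) \<le> norm (a m *\<^sub>R (\<Sum>k<Suc m. f k)) +
      norm (\<Sum>k<m. (a k - a (Suc k)) *\<^sub>R (\<Sum>j<Suc k. f j))"
    unfolding Suc abel_sum_eq by (rule norm_triangle_ineq)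
  also have "norm (a m *\<^sub>R (\<Sum>k<Suc m. f k)) \<le> a m * M"
    unfolding norm_scaleR using assms(1)[of m] assms(3)[of "Suc m"] assms(4) Suc
    by (auto intro!: mult_left_mono)
  also have "norm (\<Sum>k<m. (a k - a (Suc k)) *\<^sub>R (\<Sum>j<Suc k. f j)) \<le> (\<Sum>k<m. (a k - a (Suc k)) * M)"
  proof (rule sum_norm_le)
    fix k assume "k \<in> {..<m}"
    then have "norm (\<Sum>j<Suc k. f j) \<le> M" using assms(4) Suc by (intro assms(3)) auto
    then show "norm ((a k - a (Suc k)) *\<^sub>R (\<Sum>j<Suc k. f j)) \<le> (a k - a (Suc k)) * M"
      unfolding norm_scaleR using assms(2)[of k] by (auto intro!: mult_left_mono)
  qed
  also have "(\<Sum>k<m. (a k - a (Suc k)) * M) = (a 0 - a m) * M"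
    by (simp add: sum_lessThan_telescope' flip: sum_distrib_right)
  finally show ?thesis by (simp add: algebra_simps)
qed

section \<open>Contraction of a product over one block, without and with noise\<close>

text \<open>
  The energy lost along the product is at least \<open>D = (\<Sum>k. x k \<bullet> (B k *v x k))\<close>. If \<open>D\<close> is small, then
  the \<open>x k\<close> stay close to \<open>x 0\<close>, so \<open>D\<close> is comparable to \<open>(\<Sum>k. x 0 \<bullet> (B k *v x 0)) \<ge> d |x 0|\<^sup>2\<close>.
\<close>

lemma psd_product_contraction:
  fixes B :: "nat \<Rightarrow> real ^ 'n ^ 'n" and x :: "nat \<Rightarrow> real ^ 'n"
  assumes sym: "\<And>k. k < N \<Longrightarrow> symmetric_matrix (B k)"
    and psd: "\<And>k. k < N \<Longrightarrow> positive_semidefinite (B k)"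
    and tr: "\<And>k. k < N \<Longrightarrow> trace (B k) \<le> 1"
    and step: "\<And>k. k < N \<Longrightarrow> x (Suc k) = x k - B k *v x k"
    and C: "(\<Sum>k<N. trace (B k)) \<le> C"
    and d: "\<And>v. d * (norm v)\<^sup>2 \<le> (\<Sum>k<N. v \<bullet> (B k *v v))"
  shows "(norm (x N))\<^sup>2 \<le> (1 - d / (2 + 2 * C\<^sup>2)) * (norm (x 0))\<^sup>2"
proof -
  define q where "q k v = v \<bullet> (B k *v v)" for k v
  define D where "D = (\<Sum>k<N. q k (x k))"
  have q0: "0 \<le> q k v" if "k < N" for k v
    using psd[OF that] by (simp add: q_def positive_semidefinite_def)
  have tr0: "0 \<le> trace (B k)" if "k < N" for k
    using psd[OF that] by (rule trace_nonneg)
  have D0: "0 \<le> D" unfolding D_def by (intro sum_nonneg) (auto simp: q0)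
  have C0: "0 \<le> C" using C sum_nonneg[of "{..<N}" "\<lambda>k. trace (B k)"] tr0 by auto
  have energy: "(norm (x n))\<^sup>2 \<le> (norm (x 0))\<^sup>2 - (\<Sum>k<n. q k (x k))" if "n \<le> N" for n
    using that
  proof (induction n)
    case (Suc n)
    then show ?case
      using norm_diff_psd_mult_sq_le[OF sym psd tr, of n "x n"] step[of n]
      by (simp add: q_def)
  qed simp
  \<comment> \<open>The displacement is a sum of increments; Cauchy-Schwarz over \<open>k\<close>
    separates the total trace from the dissipated energy.\<close>
  have drift: "(norm (x 0 - x n))\<^sup>2 \<le> C * D" if "n \<le> N" for n
  proof -
    have eq: "x 0 - x n = (\<Sum>k<n. B k *v x k)"
      using that
    proof (induction n)
      case (Suc n)
      then show ?case using step[of n] by (simp add: algebra_simps)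
    qed simp
    have "norm (x 0 - x n) \<le> (\<Sum>k<n. sqrt (trace (B k)) * sqrt (q k (x k)))"
      unfolding eq
    proof (rule sum_norm_le)
      fix k assume "k \<in> {..<n}"
      then have k: "k < N" using that by simp
      have "(norm (B k *v x k))\<^sup>2 \<le> trace (B k) * q k (x k)"
        unfolding q_def by (intro norm_psd_mult_sq_le sym psd k)
      then show "norm (B k *v x k) \<le> sqrt (trace (B k)) * sqrt (q k (x k))"
        by (simp add: real_le_rsqrt flip: real_sqrt_mult)
    qed
    then have "(norm (x 0 - x n))\<^sup>2 \<le> (\<Sum>k<n. sqrt (trace (B k)) * sqrt (q k (x k)))\<^sup>2"
      by (intro power_mono) auto
    also have "\<dots> \<le> (\<Sum>k<n. (sqrt (trace (B k)))\<^sup>2) * (\<Sum>k<n. (sqrt (q k (x k)))\<^sup>2)"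
      by (rule Cauchy_Schwarz_ineq_sum)
    also have "\<dots> = (\<Sum>k<n. trace (B k)) * (\<Sum>k<n. q k (x k))"
      using that tr0 q0 by (intro arg_cong2[of _ _ _ _ "(*)"] sum.cong) auto
    also have "\<dots> \<le> (\<Sum>k<N. trace (B k)) * D"
      unfolding D_def using that tr0 q0
      by (intro mult_mono sum_mono2 sum_nonneg) auto
    also have "\<dots> \<le> C * D" using C D0 by (rule mult_right_mono)
    finally show ?thesis .
  qed
  have "d * (norm (x 0))\<^sup>2 \<le> (\<Sum>k<N. q k (x 0))" unfolding q_def by (rule d)
  \<comment> \<open>Passing from \<open>x 0\<close> to \<open>x k\<close> costs the factor 2 of
    \<open>psd_form_add_le\<close>. The first terms sum to \<open>2 * D\<close>; by
    \<open>drift\<close> the others sum to at most \<open>2 * C\<^sup>2 * D\<close>, whence the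
    constant \<open>2 + 2 * C\<^sup>2\<close>.\<close>
  also have "\<dots> \<le> (\<Sum>k<N. 2 * q k (x k) + 2 * (trace (B k) * (C * D)))"
  proof (rule sum_mono)
    fix k assume "k \<in> {..<N}"
    then have k: "k < N" by simp
    have "q k (x 0) = q k (x k + (x 0 - x k))" by simp
    also have "\<dots> \<le> 2 * q k (x k) + 2 * q k (x 0 - x k)"
      unfolding q_def by (rule psd_form_add_le[OF psd[OF k]])
    also have "q k (x 0 - x k) \<le> trace (B k) * (norm (x 0 - x k))\<^sup>2"
      unfolding q_def by (intro psd_form_le sym psd k)
    also have "\<dots> \<le> trace (B k) * (C * D)"
      using k by (intro mult_left_mono drift tr0) auto
    finally show "q k (x 0) \<le> 2 * q k (x k) + 2 * (trace (B k) * (C * D))" by simp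
  qed
  also have "\<dots> = 2 * D + 2 * ((\<Sum>k<N. trace (B k)) * (C * D))"
    by (simp add: D_def sum.distrib flip: sum_distrib_left sum_distrib_right)
  also have "\<dots> \<le> 2 * D + 2 * (C * (C * D))"
    using C C0 D0 by (intro add_left_mono mult_left_mono mult_right_mono) auto
  also have "\<dots> = (2 + 2 * C\<^sup>2) * D" by (simp add: power2_eq_square algebra_simps)
  finally have "d * (norm (x 0))\<^sup>2 / (2 + 2 * C\<^sup>2) \<le> D"
    by (simp add: divide_le_eq add_pos_nonneg mult.commute)
  with energy[of N] show ?thesis by (simp add: D_def algebra_simps)
qed

text \<open>The noise is measured through its partial sums only, so cancellation among the
  \<open>w k\<close> is kept. Compared with the noiseless run \<open>x\<close> from the same start,
  \<open>y\<close> differs by the partial sum itself, at most \<open>M\<close>, and by a remainder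
  of at most \<open>C * M\<close>. The second conclusion controls the times inside a block.\<close>

lemma psd_product_perturbed:
  fixes B :: "nat \<Rightarrow> real ^ 'n ^ 'n" and y w :: "nat \<Rightarrow> real ^ 'n"
  assumes sym: "\<And>k. k < N \<Longrightarrow> symmetric_matrix (B k)"
    and psd: "\<And>k. k < N \<Longrightarrow> positive_semidefinite (B k)"
    and tr: "\<And>k. k < N \<Longrightarrow> trace (B k) \<le> 1"
    and step: "\<And>k. k < N \<Longrightarrow> y (Suc k) = y k - B k *v y k + w k"
    and C: "(\<Sum>k<N. trace (B k)) \<le> C"
    and d: "\<And>v. d * (norm v)\<^sup>2 \<le> (\<Sum>k<N. v \<bullet> (B k *v v))"
    and M: "\<And>k. k \<le> N \<Longrightarrow> norm (\<Sum>j<k. w j) \<le> M"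
  shows "norm (y N) \<le> sqrt (1 - d / (2 + 2 * C\<^sup>2)) * norm (y 0) + (1 + C) * M"
    and "k \<le> N \<Longrightarrow> norm (y k) \<le> norm (y 0) + (1 + C) * M"
proof -
  define x where "x = rec_nat (y 0) (\<lambda>k v. v - B k *v v)"
  have x0: "x 0 = y 0" and xS: "x (Suc k) = x k - B k *v x k" for k
    by (simp_all add: x_def)
  \<comment> \<open>\<open>y k - U k\<close> is driven by \<open>B k *v U k\<close>, which is summable over the block, instead of by \<open>w k\<close>.\<close>
  define U where "U k = (\<Sum>j<k. w j)" for k
  have tr0: "0 \<le> trace (B k)" if "k < N" for k
    using psd[OF that] by (rule trace_nonneg)
  have M0: "0 \<le> M" using M[of 0] by simp
  have z: "norm (y k - U k - x k) \<le> (\<Sum>j<k. trace (B j)) * M" if "k \<le> N" for k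
    using that
  proof (induction k)
    case 0
    show ?case by (simp add: x0 U_def)
  next
    case (Suc k)
    then have k: "k < N" by simp
    let ?v = "y k - U k - x k"
    \<comment> \<open>The remainder follows the noiseless recursion, which does not expand norms,
      with the extra term \<open>- (B k *v U k)\<close>.\<close>
    have "y (Suc k) - U (Suc k) - x (Suc k) = (?v - B k *v ?v) - B k *v U k"
      by (simp add: step[OF k] xS U_def matrix_vector_mult_diff_distrib)
    also have "norm \<dots> \<le> norm (?v - B k *v ?v) + norm (B k *v U k)"
      by (rule norm_triangle_ineq4)
    also have "norm (?v - B k *v ?v) \<le> norm ?v"
      by (intro norm_diff_psd_mult_le sym psd tr k)
    also have "norm ?v \<le> (\<Sum>j<k. trace (B j)) * M" using Suc by simp
    also have "norm (B k *v U k) \<le> trace (B k) * norm (U k)"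
      by (intro norm_psd_mult_le sym psd k)
    also have "\<dots> \<le> trace (B k) * M"
      using M[of k] k by (intro mult_left_mono tr0) (auto simp: U_def)
    finally show ?case by (simp add: algebra_simps)
  qed
  have y: "norm (y k) \<le> norm (x k) + (1 + C) * M" if "k \<le> N" for k
  proof -
    have "y k = x k + U k + (y k - U k - x k)" by simp
    then have "norm (y k) \<le> norm (x k) + norm (U k) + norm (y k - U k - x k)"
      by (metis norm_triangle_mono norm_triangle_ineq order_refl)
    also have "norm (U k) \<le> M" unfolding U_def by (rule M[OF that])
    also have "norm (y k - U k - x k) \<le> (\<Sum>j<k. trace (B j)) * M" by (rule z[OF that])
    also have "\<dots> \<le> C * M"
    proof (rule mult_right_mono[OF order_trans[OF _ C] M0])
      show "(\<Sum>j<k. trace (B j)) \<le> (\<Sum>k<N. trace (B k))"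
        using that tr0 by (intro sum_mono2) auto
    qed
    finally show ?thesis by (simp add: algebra_simps)
  qed
  have mono: "norm (x k) \<le> norm (y 0)" if "k \<le> N" for k
    using that
  proof (induction k)
    case (Suc k)
    then show ?case
      using norm_diff_psd_mult_le[OF sym psd tr, of k "x k"] by (simp add: xS)
  qed (simp add: x0)
  show "k \<le> N \<Longrightarrow> norm (y k) \<le> norm (y 0) + (1 + C) * M"
    using y[of k] mono[of k] by linarith
  have "(norm (x N))\<^sup>2 \<le> (1 - d / (2 + 2 * C\<^sup>2)) * (norm (y 0))\<^sup>2"
    using psd_product_contraction[of N B x C d] sym psd tr C d by (simp add: x0 xS)
  then have "norm (x N) \<le> sqrt ((1 - d / (2 + 2 * C\<^sup>2)) * (norm (y 0))\<^sup>2)"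
    by (rule real_le_rsqrt)
  then show "norm (y N) \<le> sqrt (1 - d / (2 + 2 * C\<^sup>2)) * norm (y 0) + (1 + C) * M"
    using y[of N] by (simp add: real_sqrt_mult)
qed

section \<open>From contraction along block starts to convergence of the whole sequence\<close>

lemma tendsto_0_of_block_contraction:
  fixes v :: "nat \<Rightarrow> real" and m :: "nat \<Rightarrow> nat"
  assumes "\<And>n. 0 \<le> v n" "\<And>n. 1 \<le> m n" "0 \<le> r" "r < 1"
    and step: "\<And>e. 0 < e \<Longrightarrow> \<forall>\<^sub>F n in sequentially.
      v (n + m n) \<le> r * v n + e \<and> (\<forall>j\<le>m n. v (n + j) \<le> 2 * v n + e)"
  shows "v \<longlonglongrightarrow> 0"
proof (rule LIMSEQ_I)
  fix e' :: real assume "0 < e'"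
  \<comment> \<open>This choice makes \<open>e / (1 - r)\<close> equal to \<open>e' / 8\<close>, so
    the final bound is \<open>2 * (e'/8 + e'/8) + e'/8 < e'\<close>.\<close>
  define e where "e = e' / 8 * (1 - r)"
  have e: "0 < e" using \<open>0 < e'\<close> assms(4) by (simp add: e_def)
  obtain N where N: "v (n + m n) \<le> r * v n + e" "j \<le> m n \<Longrightarrow> v (n + j) \<le> 2 * v n + e"
    if "n \<ge> N" for n j
    using step[OF e] unfolding eventually_sequentially by metis
  define t where "t = rec_nat N (\<lambda>_ n. n + m n)"
  have t0: "t 0 = N" and tS: "t (Suc i) = t i + m (t i)" for i by (simp_all add: t_def)
  have smt: "strict_mono t"
    unfolding strict_mono_Suc_iff using assms(2) by (simp add: tS less_eq_Suc_le)
  have tN: "N \<le> t i" for i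
    using strict_mono_less_eq[OF smt, of 0 i] by (simp add: t0)
  \<comment> \<open>The term \<open>e / (1 - r)\<close> is the fixed point of the map sending
    \<open>u\<close> to \<open>r * u + e\<close>.\<close>
  have vt: "v (t i) \<le> r ^ i * v N + e / (1 - r)" for i
  proof (induction i)
    case 0
    show ?case using e assms(4) by (simp add: t0)
  next
    case (Suc i)
    have "v (t (Suc i)) \<le> r * v (t i) + e" unfolding tS by (rule N(1)[OF tN])
    also have "\<dots> \<le> r * (r ^ i * v N + e / (1 - r)) + e"
      using Suc assms(3) by (intro add_right_mono mult_left_mono)
    also have "\<dots> = r ^ Suc i * v N + e / (1 - r)"
      using assms(4) by (simp add: field_simps)
    finally show ?case .
  qed
  have "(\<lambda>i. r ^ i * v N) \<longlonglongrightarrow> 0"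
    using assms(3,4) by (intro tendsto_mult_left_zero LIMSEQ_power_zero) auto
  then have "\<forall>\<^sub>F i in sequentially. r ^ i * v N < e'/8"
    using \<open>0 < e'\<close> by (intro order_tendstoD) auto
  then obtain I where I: "\<And>i. i \<ge> I \<Longrightarrow> r ^ i * v N < e'/8"
    unfolding eventually_sequentially by blast
  show "\<exists>no. \<forall>n\<ge>no. norm (v n - 0) < e'"
  proof (intro exI allI impI)
    fix n assume n: "t I \<le> n"
    \<comment> \<open>The block containing \<open>n\<close> is the last one starting at or before
      \<open>n\<close>; it exists because \<open>k \<le> t k\<close> bounds the candidates.\<close>
    define i where "i = (GREATEST i. t i \<le> n)"
    have bound: "\<And>k. t k \<le> n \<Longrightarrow> k \<le> n"
      using strict_mono_imp_increasing[OF smt] order_trans by blast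
    have i: "t i \<le> n" unfolding i_def by (rule GreatestI_nat[where P = "\<lambda>i. t i \<le> n", OF n bound])
    have Ii: "I \<le> i" unfolding i_def by (rule Greatest_le_nat[where P = "\<lambda>i. t i \<le> n", OF n bound])
    have "\<not> t (Suc i) \<le> n"
      using Greatest_le_nat[where P = "\<lambda>i. t i \<le> n" and k = "Suc i", OF _ bound] unfolding i_def by fastforce
    then have "n - t i \<le> m (t i)" by (simp add: tS)
    from N(2)[OF tN this] have "v n \<le> 2 * v (t i) + e" using i by simp
    also have "v (t i) \<le> e' / 8 + e / (1 - r)" using vt[of i] I[OF Ii] by simp
    also have "e / (1 - r) = e' / 8"
      unfolding e_def using assms(4) by (intro nonzero_mult_div_cancel_right) simp
    also have "e \<le> e' / 8"
      using assms(3) \<open>0 < e'\<close> by (simp add: e_def mult_left_le)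
    finally show "norm (v n - 0) < e'" using assms(1)[of n] \<open>0 < e'\<close> by simp
  qed
qed

section \<open>Sums over windows and blocks\<close>

text \<open>A window sum is the difference of two partial sums with indices at most
  \<open>2 * n\<close>. Since \<open>p < 1\<close>, doubling the index at most doubles the power, so
  \<open>e / 4\<close> becomes \<open>e / 2\<close> for each of them.\<close>

lemma sum_window_eventually_le:
  fixes f :: "nat \<Rightarrow> 'a :: real_normed_vector"
  assumes p: "0 < p" "p < 1" and e: "0 < e"
    and lim: "(\<lambda>n. (1 / real n powr p) *\<^sub>R (\<Sum>k=1..n. f k)) \<longlonglongrightarrow> 0"
  shows "\<forall>\<^sub>F n in sequentially. \<forall>j\<le>n. norm (\<Sum>k<j. f (n + k)) \<le> e * real n powr p"
proof -
  define S where "S n = (\<Sum>k=1..n. f k)" for n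
  have "\<forall>\<^sub>F n in sequentially. norm ((1 / real n powr p) *\<^sub>R S n) < e / 4"
    using lim e unfolding S_def by (intro order_tendstoD(2)[where y = 0] tendsto_norm_zero) auto
  then obtain N where N: "\<And>n. n \<ge> N \<Longrightarrow> norm ((1 / real n powr p) *\<^sub>R S n) < e / 4"
    unfolding eventually_sequentially by blast
  have S: "norm (S i) \<le> e / 2 * real n powr p" if "N \<le> i" "1 \<le> i" "i \<le> 2 * n" for i n
  proof -
    have "norm (S i) \<le> e / 4 * real i powr p"
      using N[OF that(1)] that(2) by (simp add: field_simps)
    also have "\<dots> \<le> e / 4 * (2 * real n) powr p"
      using that e p by (intro mult_left_mono powr_mono2) auto
    also have "\<dots> = e / 4 * (2 powr p * real n powr p)" by (simp add: powr_mult)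
    also have "\<dots> \<le> e / 4 * (2 * real n powr p)"
      using e p powr_mono[of p 1 2] by (intro mult_left_mono mult_right_mono) auto
    finally show ?thesis by simp
  qed
  \<comment> \<open>The offset 2 makes \<open>n - 1\<close>, the index just before the window, at
    least 1 and at least \<open>N\<close>.\<close>
  have "\<forall>j\<le>n. norm (\<Sum>k<j. f (n + k)) \<le> e * real n powr p" if "n \<ge> N + 2" for n
  proof (intro allI impI)
    fix j assume j: "j \<le> n"
    have "S (n - 1) + (\<Sum>k<j. f (n + k)) = S (n - 1 + j)"
    proof (induction j)
      case (Suc j)
      have "S (Suc i) = S i + f (Suc i)" for i by (simp add: S_def)
      moreover have "n + j = Suc (n - 1 + j)" using that by simp
      ultimately have "S (n - 1 + Suc j) = S (n - 1 + j) + f (n + j)"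
        by (metis add_Suc_right)
      then show ?case using Suc by (simp add: algebra_simps)
    qed simp
    then have "(\<Sum>k<j. f (n + k)) = S (n - 1 + j) - S (n - 1)" by (simp add: algebra_simps)
    also have "norm \<dots> \<le> norm (S (n - 1 + j)) + norm (S (n - 1))" by (rule norm_triangle_ineq4)
    also have "\<dots> \<le> e / 2 * real n powr p + e / 2 * real n powr p"
      using that j by (intro add_mono S) auto
    finally show "norm (\<Sum>k<j. f (n + k)) \<le> e * real n powr p" by simp
  qed
  then show ?thesis unfolding eventually_sequentially by blast
qed

text \<open>The \<open>Suc\<close> makes every block nonempty, so block starts advance, and gives it
  length at least \<open>n powr chi\<close>.\<close>

definition block_length :: "real \<Rightarrow> nat \<Rightarrow> nat" where
  "block_length chi n = Suc (nat \<lfloor>real n powr chi\<rfloor>)"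

lemma block_length_bounds:
  "real n powr chi \<le> real (block_length chi n)" "real (block_length chi n) \<le> real n powr chi + 1"
  unfolding block_length_def by (simp_all add: of_nat_nat) linarith

lemma powr_double_le:
  assumes "0 < chi" "chi < 1" "0 \<le> x"
  shows "(2 * x) powr chi \<le> 2 * x powr (chi :: real)"
proof -
  have "(2 * x) powr chi = 2 powr chi * x powr chi" using assms by (simp add: powr_mult)
  also have "\<dots> \<le> 2 * x powr chi"
    using assms powr_mono[of chi 1 2] by (intro mult_right_mono) auto
  finally show ?thesis .
qed

text \<open>Over a block the \<open>Abar\<close> sum to \<open>real (?m n) *\<^sub>R A\<close> plus
  an error \<open>E\<close> that is small against \<open>n powr chi\<close>, because
  \<open>p \<le> chi\<close>. All indices lie between \<open>n\<close> and \<open>2 * n\<close>, so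
  the step sizes agree up to a factor 2.\<close>

lemma block_matrix_bounds:
  fixes Abar :: "nat \<Rightarrow> real ^ 'd ^ 'd"
  assumes chi: "0 < chi" "chi < 1" and p: "0 < p" "p \<le> chi"
    and psd: "\<And>k. 1 \<le> k \<Longrightarrow> positive_semidefinite (Abar k)"
    and A: "positive_definite A"
    and lim: "(\<lambda>n. (1 / real n powr p) *\<^sub>R (\<Sum>k=1..n. (Abar k - A))) \<longlonglongrightarrow> 0"
  obtains C d where "0 \<le> C" "0 < d"
    "\<forall>\<^sub>F n in sequentially. (\<forall>k. trace ((1 / real (n + k) powr chi) *\<^sub>R Abar (n + k)) \<le> 1) \<and>
      (\<Sum>k<block_length chi n. trace ((1 / real (n + k) powr chi) *\<^sub>R Abar (n + k))) \<le> C \<and>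
      (\<forall>v. d * (norm v)\<^sup>2 \<le>
        (\<Sum>k<block_length chi n. v \<bullet> (((1 / real (n + k) powr chi) *\<^sub>R Abar (n + k)) *v v)))"
proof -
  let ?a = "\<lambda>n. 1 / real n powr chi"
  let ?m = "block_length chi"
  let ?D = "real CARD('d)"
  obtain l where l: "0 < l" "\<And>x. l * (norm x)\<^sup>2 \<le> x \<bullet> (A *v x)"
    using positive_definite_coercive[OF A] by blast
  have psdA: "positive_semidefinite A"
    using A unfolding positive_definite_def positive_semidefinite_def
    by (metis inner_zero_left less_eq_real_def order_refl)
  have trA: "0 \<le> trace A" by (rule trace_nonneg[OF psdA])
  have D: "0 < ?D" by simp
  \<comment> \<open>At most \<open>2 * n powr chi\<close> copies of \<open>A\<close>, plus
    \<open>E\<close> with norm at most \<open>l / 2 * n powr chi\<close>, whose trace costs the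
    dimension factor.\<close>
  define C where "C = 2 * trace A + ?D * (l / 2)"
  \<comment> \<open>A window of length one shows that a single \<open>Abar n\<close> exceeds
    \<open>A\<close> in trace by at most half of \<open>n powr chi\<close>.\<close>
  have ev1: "\<forall>\<^sub>F n in sequentially. \<forall>i\<ge>n. trace (Abar i) \<le> real i powr chi"
  proof (rule eventually_all_ge_at_top)
    have w: "\<forall>\<^sub>F n in sequentially. \<forall>j\<le>n. norm (\<Sum>k<j. (Abar (n + k) - A)) \<le> 1 / (2 * ?D) * real n powr p"
      using p chi by (intro sum_window_eventually_le[OF _ _ _ lim]) auto
    have "filterlim (\<lambda>n. real n powr chi) at_top sequentially"
      using chi by real_asymp
    then have "\<forall>\<^sub>F n in sequentially. 2 * trace A \<le> real n powr chi"
      by (simp add: filterlim_at_top)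
    with w eventually_ge_at_top[of 1]
    show "\<forall>\<^sub>F i in sequentially. trace (Abar i) \<le> real i powr chi"
    proof eventually_elim
      case (elim n)
      have "trace (Abar n) = trace A + trace (Abar n - A)" by (simp add: trace_sub)
      also have "trace (Abar n - A) \<le> ?D * norm (Abar n - A)"
        using abs_trace_le[of "Abar n - A"] by linarith
      also have "norm (Abar n - A) \<le> 1 / (2 * ?D) * real n powr p"
        using elim(1)[rule_format, of 1] elim(2) by simp
      also have "?D * (1 / (2 * ?D) * real n powr p) = real n powr p / 2" by simp
      also have "real n powr p \<le> real n powr chi" using p elim(2) by (intro powr_mono) auto
      finally show ?case using elim(3) by simp
    qed
  qed
  have ev2: "\<forall>\<^sub>F n in sequentially. \<forall>j\<le>n. norm (\<Sum>k<j. (Abar (n + k) - A)) \<le> l / 2 * real n powr p"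
    using p chi l(1) by (intro sum_window_eventually_le[OF _ _ _ lim]) auto
  have ev3: "\<forall>\<^sub>F n in sequentially. real n powr chi + 1 \<le> real n" using chi by real_asymp
  show ?thesis
  proof (rule that)
    show "0 \<le> C" using trA l by (simp add: C_def)
    \<comment> \<open>The copies of \<open>A\<close> contribute at least
      \<open>l * n powr chi\<close>, \<open>E\<close> removes at most half of that, and step sizes
      of at least \<open>1 / (2 * n powr chi)\<close> leave \<open>l / 4\<close>.\<close>
    show "0 < l / 4" using l by simp
    show "\<forall>\<^sub>F n in sequentially. (\<forall>k. trace (?a (n + k) *\<^sub>R Abar (n + k)) \<le> 1) \<and>
        (\<Sum>k<?m n. trace (?a (n + k) *\<^sub>R Abar (n + k))) \<le> C \<and>
        (\<forall>v. l / 4 * (norm v)\<^sup>2 \<le> (\<Sum>k<?m n. v \<bullet> ((?a (n + k) *\<^sub>R Abar (n + k)) *v v)))"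
      using ev1 ev2 ev3 eventually_ge_at_top[of 1]
    proof eventually_elim
      case (elim n)
      have n0: "0 < real n powr chi" using elim(4) by simp
      have n1: "1 \<le> real n powr chi" using elim(4) chi by (simp add: ge_one_powr_ge_zero)
      note m = block_length_bounds[where n = n and chi = chi]
      have mn: "?m n \<le> n" using m elim(3) by linarith
      define E where "E = (\<Sum>k<?m n. (Abar (n + k) - A))"
      have sumA: "(\<Sum>k<?m n. Abar (n + k)) = real (?m n) *\<^sub>R A + E"
        unfolding E_def sum_subtractf sum_constant_scaleR by simp
      have "norm E \<le> l / 2 * real n powr p" using elim(2) mn by (simp add: E_def)
      also have "\<dots> \<le> l / 2 * real n powr chi"
        using p elim(4) l by (intro mult_left_mono powr_mono) auto
      finally have E: "norm E \<le> l / 2 * real n powr chi" .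
      have "trace (?a (n + k) *\<^sub>R Abar (n + k)) \<le> 1" for k
        using elim(1)[rule_format, of "n + k"] elim(4)
        by (simp add: trace_scaleR divide_le_eq)
      moreover have "(\<Sum>k<?m n. trace (?a (n + k) *\<^sub>R Abar (n + k))) \<le> C"
      proof -
        have "trace (\<Sum>k<?m n. Abar (n + k)) = real (?m n) * trace A + trace E"
          by (simp add: sumA trace_add trace_scaleR)
        also have "\<dots> \<le> (2 * real n powr chi) * trace A + ?D * (l / 2 * real n powr chi)"
        proof (rule add_mono)
          show "real (?m n) * trace A \<le> (2 * real n powr chi) * trace A"
            using m n1 trA by (intro mult_right_mono) auto
          have "trace E \<le> ?D * norm E" using abs_trace_le[of E] by linarith
          also have "\<dots> \<le> ?D * (l / 2 * real n powr chi)" using E by (intro mult_left_mono) auto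
          finally show "trace E \<le> ?D * (l / 2 * real n powr chi)" .
        qed
        also have "\<dots> = real n powr chi * C" by (simp add: C_def algebra_simps)
        finally have *: "trace (\<Sum>k<?m n. Abar (n + k)) \<le> real n powr chi * C" .
        have "(\<Sum>k<?m n. trace (?a (n + k) *\<^sub>R Abar (n + k))) \<le> (\<Sum>k<?m n. ?a n * trace (Abar (n + k)))"
          unfolding trace_scaleR using elim(4) chi n0
          by (intro sum_mono mult_right_mono trace_nonneg psd divide_left_mono powr_mono2) auto
        also have "\<dots> = ?a n * trace (\<Sum>k<?m n. Abar (n + k))"
          by (simp add: trace_sum sum_distrib_left)
        also have "\<dots> \<le> ?a n * (real n powr chi * C)"
          using * by (intro mult_left_mono) auto
        finally show ?thesis using elim(4) by simp
      qed
      moreover have "l / 4 * (norm v)\<^sup>2 \<le> (\<Sum>k<?m n. v \<bullet> ((?a (n + k) *\<^sub>R Abar (n + k)) *v v))" for v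
      proof -
        have "l / 2 * real n powr chi * (norm v)\<^sup>2 \<le>
            real (?m n) * (l * (norm v)\<^sup>2) - l / 2 * real n powr chi * (norm v)\<^sup>2"
          using mult_right_mono[OF m(1), of "l * (norm v)\<^sup>2"] l(1) by (simp add: algebra_simps)
        also have "\<dots> \<le> real (?m n) * (v \<bullet> (A *v v)) + v \<bullet> (E *v v)"
        proof -
          have "real (?m n) * (l * (norm v)\<^sup>2) \<le> real (?m n) * (v \<bullet> (A *v v))"
            by (intro mult_left_mono l) simp
          moreover have "\<bar>v \<bullet> (E *v v)\<bar> \<le> l / 2 * real n powr chi * (norm v)\<^sup>2"
            using abs_inner_matrix_vector_le[of v E] mult_right_mono[OF E, of "(norm v)\<^sup>2"] by simp
          ultimately show ?thesis by linarith
        qed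
        also have "\<dots> = v \<bullet> ((\<Sum>k<?m n. Abar (n + k)) *v v)"
          by (simp add: sumA matrix_vector_mult_add_rdistrib inner_add_right flip: scaleR_matrix_vector_assoc)
        also have "\<dots> = (\<Sum>k<?m n. v \<bullet> (Abar (n + k) *v v))"
          by (simp add: sum_matrix_vector_mult inner_sum_right)
        finally have "l / 2 * real n powr chi * (norm v)\<^sup>2 \<le> (\<Sum>k<?m n. v \<bullet> (Abar (n + k) *v v))" .
        then have "1 / (2 * real n powr chi) * (l / 2 * real n powr chi * (norm v)\<^sup>2) \<le>
            1 / (2 * real n powr chi) * (\<Sum>k<?m n. v \<bullet> (Abar (n + k) *v v))"
          by (intro mult_left_mono) auto
        also have "\<dots> = (\<Sum>k<?m n. 1 / (2 * real n powr chi) * (v \<bullet> (Abar (n + k) *v v)))"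
          by (simp add: sum_distrib_left)
        also have "\<dots> \<le> (\<Sum>k<?m n. ?a (n + k) * (v \<bullet> (Abar (n + k) *v v)))"
        proof (intro sum_mono mult_right_mono)
          fix k assume "k \<in> {..<?m n}"
          then have "real (n + k) powr chi \<le> (2 * real n) powr chi"
            using mn chi by (intro powr_mono2) auto
          also have "\<dots> \<le> 2 * real n powr chi" using chi by (intro powr_double_le) auto
          finally show "1 / (2 * real n powr chi) \<le> ?a (n + k)"
            using elim(4) by (intro divide_left_mono) auto
          show "0 \<le> v \<bullet> (Abar (n + k) *v v)"
            using psd[of "n + k"] elim(4) by (simp add: positive_semidefinite_def)
        qed
        finally show ?thesis using n0 by (simp flip: scaleR_matrix_vector_assoc)
      qed
      ultimately show ?case by blast
    qed
  qed
qed

section \<open>The error recursion over one block\<close>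

lemma block_error_contraction:
  fixes Abar :: "nat \<Rightarrow> real ^ 'd ^ 'd" and e xi :: "nat \<Rightarrow> real ^ 'd"
  assumes chi: "0 < chi" "chi < 1" and \<gamma>: "0 \<le> \<gamma>" "\<gamma> < chi"
    and sym: "\<And>k. 1 \<le> k \<Longrightarrow> symmetric_matrix (Abar k)"
    and psd: "\<And>k. 1 \<le> k \<Longrightarrow> positive_semidefinite (Abar k)"
    and A: "positive_definite A"
    and step: "\<And>k. 1 \<le> k \<Longrightarrow>
      e (Suc k) = e k - (1 / real k powr chi) *\<^sub>R (Abar k *v e k) + (1 / real k powr chi) *\<^sub>R xi k"
    and limxi: "(\<lambda>n. (1 / real n powr (chi - \<gamma>)) *\<^sub>R (\<Sum>k=1..n. xi k)) \<longlonglongrightarrow> 0"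
    and limA: "(\<lambda>n. (1 / real n powr (chi - \<gamma>)) *\<^sub>R (\<Sum>k=1..n. (Abar k - A))) \<longlonglongrightarrow> 0"
  obtains s where "s < 1" "\<And>\<eta>. 0 < \<eta> \<Longrightarrow> \<forall>\<^sub>F n in sequentially.
      norm (e (n + block_length chi n)) \<le> s * norm (e n) + \<eta> * real n powr (- \<gamma>) \<and>
      (\<forall>j\<le>block_length chi n. norm (e (n + j)) \<le> norm (e n) + \<eta> * real n powr (- \<gamma>))"
proof -
  let ?m = "block_length chi"
  define a where "a n = 1 / real n powr chi" for n
  define B where "B n = a n *\<^sub>R Abar n" for n
  obtain C d where C: "0 \<le> C" and d: "0 < d" and
    ev: "\<forall>\<^sub>F n in sequentially. (\<forall>k. trace (B (n + k)) \<le> 1) \<and>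
      (\<Sum>k<?m n. trace (B (n + k))) \<le> C \<and>
      (\<forall>v. d * (norm v)\<^sup>2 \<le> (\<Sum>k<?m n. v \<bullet> (B (n + k) *v v)))"
    unfolding B_def a_def
    using block_matrix_bounds[OF chi _ _ psd A limA] \<gamma> by auto
  define s where "s = sqrt (1 - d / (2 + 2 * C\<^sup>2))"
  show ?thesis
  proof (rule that)
    show "s < 1" using d by (simp add: s_def add_pos_nonneg)
    fix \<eta> :: real assume \<eta>: "0 < \<eta>"
    \<comment> \<open>Cancels the factor \<open>1 + C\<close> from
      \<open>psd_product_perturbed\<close>.\<close>
    define \<epsilon> where "\<epsilon> = \<eta> / (1 + C)"
    have \<epsilon>: "0 < \<epsilon>" using \<eta> C by (simp add: \<epsilon>_def)
    have w: "\<forall>\<^sub>F n in sequentially. \<forall>j\<le>n. norm (\<Sum>k<j. xi (n + k)) \<le> \<epsilon> * real n powr (chi - \<gamma>)"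
      using chi \<gamma> \<epsilon> by (intro sum_window_eventually_le[OF _ _ _ limxi]) auto
    have "\<forall>\<^sub>F n in sequentially. real n powr chi + 1 \<le> real n" using chi by real_asymp
    with ev w eventually_ge_at_top[of 1]
    show "\<forall>\<^sub>F n in sequentially.
        norm (e (n + ?m n)) \<le> s * norm (e n) + \<eta> * real n powr (- \<gamma>) \<and>
        (\<forall>j\<le>?m n. norm (e (n + j)) \<le> norm (e n) + \<eta> * real n powr (- \<gamma>))"
    proof eventually_elim
      case (elim n)
      have mn: "?m n \<le> n" using block_length_bounds[where n = n and chi = chi] elim(4) by linarith
      have adec: "a (n + Suc k) \<le> a (n + k)" for k
        unfolding a_def using elim(3) chi by (intro divide_left_mono powr_mono2) auto
      \<comment> \<open>Abel summation leaves only the first and largest step size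
        \<open>n powr (- chi)\<close>, which turns the window bound of order
        \<open>n powr (chi - \<gamma>)\<close> into order
        \<open>n powr (- \<gamma>)\<close>.\<close>
      have noise: "norm (\<Sum>k<j. a (n + k) *\<^sub>R xi (n + k)) \<le> \<epsilon> * real n powr (- \<gamma>)" if "j \<le> ?m n" for j
      proof -
        have "norm (\<Sum>k<j. a (n + k) *\<^sub>R xi (n + k)) \<le> a (n + 0) * (\<epsilon> * real n powr (chi - \<gamma>))"
          using elim(2) mn that
          by (intro norm_abel_sum_le[where N = "?m n"] adec) (auto simp: a_def)
        also have "\<dots> = \<epsilon> * real n powr (- \<gamma>)"
          using elim(3) by (simp add: a_def powr_diff powr_minus_divide)
        finally show ?thesis .
      qed
      have sB: "symmetric_matrix (B (n + k))" for k
        using sym[of "n + k"] elim(3)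
        by (simp add: B_def symmetric_matrix_def transpose_def vec_eq_iff)
      have pB: "positive_semidefinite (B (n + k))" for k
        using psd[of "n + k"] elim(3)
        by (simp add: B_def positive_semidefinite_def a_def flip: scaleR_matrix_vector_assoc)
      have st: "e (n + Suc k) = e (n + k) - B (n + k) *v e (n + k) + a (n + k) *\<^sub>R xi (n + k)" for k
        using step[of "n + k"] elim(3) by (simp add: B_def a_def flip: scaleR_matrix_vector_assoc)
      have \<eta>_eq: "(1 + C) * (\<epsilon> * real n powr (- \<gamma>)) = \<eta> * real n powr (- \<gamma>)"
        using C by (simp add: \<epsilon>_def)
      note pert = psd_product_perturbed[where y = "\<lambda>k. e (n + k)" and B = "\<lambda>k. B (n + k)"
          and w = "\<lambda>k. a (n + k) *\<^sub>R xi (n + k)" and N = "?m n" and C = C and d = d,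
          OF sB pB _ st _ _ noise, unfolded \<eta>_eq, simplified add_0_right, folded s_def]
      show ?case using elim(1) by (intro conjI allI impI pert) auto
    qed
  qed
qed

section \<open>Convergence of the error rescaled by \<open>n powr \<gamma>\<close>\<close>

theorem corollary1:
  fixes chi \<gamma> :: real
    and Abar :: "nat \<Rightarrow> real ^ 'd ^ 'd"
    and bbar hbar :: "nat \<Rightarrow> real ^ 'd"
    and A :: "real ^ 'd ^ 'd"
    and b h :: "real ^ 'd"
  assumes "0 < chi" and "chi < 1"
    and "\<And>k. 1 \<le> k \<Longrightarrow> symmetric_matrix (Abar k)"
    and "\<And>k. 1 \<le> k \<Longrightarrow> positive_semidefinite (Abar k)"
    and "\<And>k. 1 \<le> k \<Longrightarrow>
           hbar (k + 1) = hbar k + (1 / real k powr chi) *\<^sub>R (bbar k - Abar k *v hbar k)"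
    and "0 \<le> \<gamma>" and "\<gamma> < chi"
    and "symmetric_matrix A" and "positive_definite A"
    and "h = matrix_inv A *v b"
    and "(\<lambda>n. (1 / real n powr (chi - \<gamma>)) *\<^sub>R (\<Sum>k=1..n. (bbar k - b))) \<longlonglongrightarrow> 0"
    and "(\<lambda>n. (1 / real n powr (chi - \<gamma>)) *\<^sub>R (\<Sum>k=1..n. (Abar k - A))) \<longlonglongrightarrow> 0"
  shows "(\<lambda>n. norm (hbar n - h)) \<in> o(\<lambda>n. real n powr (- \<gamma>))"
proof -
  let ?m = "block_length chi"
  define e where "e n = hbar n - h" for n
  define xi where "xi k = (bbar k - b) - (Abar k - A) *v h" for k
  \<comment> \<open>Positive definiteness makes the kernel trivial, so \<open>matrix_inv A\<close>
    is a true inverse and \<open>h\<close> solves \<open>A *v h = b\<close>.\<close>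
  have "x = 0" if "A *v x = 0" for x
    using assms(9)[unfolded positive_definite_def, rule_format, of x] that by auto
  then have "invertible A"
    by (simp add: invertible_left_inverse matrix_left_invertible_ker)
  then have "A ** matrix_inv A = mat 1"
    unfolding invertible_def matrix_inv_def by (rule someI2_ex) simp
  then have Ah: "A *v h = b"
    unfolding assms(10) by (simp add: matrix_vector_mul_assoc)
  have step: "e (Suc k) = e k - (1 / real k powr chi) *\<^sub>R (Abar k *v e k) + (1 / real k powr chi) *\<^sub>R xi k"
    if "1 \<le> k" for k
  proof -
    have "bbar k = xi k + Abar k *v h"
      by (simp add: xi_def matrix_vector_mult_diff_rdistrib Ah)
    then have "hbar (Suc k) = hbar k + (1 / real k powr chi) *\<^sub>R (xi k + Abar k *v h - Abar k *v hbar k)"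
      using assms(5)[OF that] by simp
    then show ?thesis
      by (simp add: e_def matrix_vector_mult_diff_distrib algebra_simps)
  qed
  \<comment> \<open>Evaluation at \<open>h\<close> is continuous in the matrix, which transfers the
    averaging hypothesis on \<open>Abar\<close> to the noise \<open>xi\<close>.\<close>
  have bl: "bounded_linear (\<lambda>M. M *v h :: real ^ 'd)"
    by (rule bounded_linear_intro[where K = "norm h"])
      (simp_all add: matrix_vector_mult_add_rdistrib norm_matrix_vector_mult_le
        flip: scaleR_matrix_vector_assoc)
  have "(\<lambda>n. (1 / real n powr (chi - \<gamma>)) *\<^sub>R (\<Sum>k=1..n. (bbar k - b)) -
      ((1 / real n powr (chi - \<gamma>)) *\<^sub>R (\<Sum>k=1..n. (Abar k - A))) *v h) \<longlonglongrightarrow> 0 - 0 *v h"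
    by (intro tendsto_diff assms(11) bounded_linear.tendsto[OF bl] assms(12))
  moreover have "(\<Sum>k=1..n. xi k) = (\<Sum>k=1..n. (bbar k - b)) - (\<Sum>k=1..n. (Abar k - A)) *v h" for n
    unfolding xi_def sum_matrix_vector_mult by (rule sum_subtractf)
  ultimately have limxi: "(\<lambda>n. (1 / real n powr (chi - \<gamma>)) *\<^sub>R (\<Sum>k=1..n. xi k)) \<longlonglongrightarrow> 0"
    by (simp only: scaleR_diff_right scaleR_matrix_vector_assoc matrix_vector_mult_0 diff_0_right)
  obtain s where s: "s < 1" "\<And>\<eta>. 0 < \<eta> \<Longrightarrow> \<forall>\<^sub>F n in sequentially.
      norm (e (n + ?m n)) \<le> s * norm (e n) + \<eta> * real n powr (- \<gamma>) \<and>
      (\<forall>j\<le>?m n. norm (e (n + j)) \<le> norm (e n) + \<eta> * real n powr (- \<gamma>))"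
    using block_error_contraction[OF assms(1,2,6,7,3,4,9) step limxi assms(12)] by blast
  \<comment> \<open>Only \<open>s < 1\<close> is known; truncation at 0 supplies a nonnegative
    ratio.\<close>
  define s0 where "s0 = max s 0"
  have s0: "0 \<le> s0" "s0 < 1" "s \<le> s0" using s(1) by (auto simp: s0_def)
  \<comment> \<open>\<open>K\<close> is the allowance for the growth of
    \<open>n powr \<gamma>\<close> within a block: above 1, yet \<open>K * s0\<close> stays below 1.
    The bound \<open>Ks\<close> is the inequality of arithmetic and geometric means for 1 and
    \<open>s0\<close>.\<close>
  define K where "K = 2 / (1 + s0)"
  have K: "1 < K" "K \<le> 2" using s0 by (auto simp: K_def field_simps)
  have Ks: "K * s0 \<le> (1 + s0) / 2"
  proof -
    have "4 * s0 \<le> (1 + s0)\<^sup>2" using sum_squares_bound[of 1 s0] by (simp add: power2_eq_square algebra_simps)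
    then show ?thesis using s0 by (simp add: K_def field_simps power2_eq_square)
  qed
  define v where "v n = real n powr \<gamma> * norm (e n)" for n
  have "v \<longlonglongrightarrow> 0"
  proof (rule tendsto_0_of_block_contraction[where m = ?m and r = "(1 + s0) / 2"])
    fix \<epsilon> :: real assume "0 < \<epsilon>"
    then have ev: "\<forall>\<^sub>F n in sequentially.
      norm (e (n + ?m n)) \<le> s * norm (e n) + \<epsilon> / 2 * real n powr (- \<gamma>) \<and>
      (\<forall>j\<le>?m n. norm (e (n + j)) \<le> norm (e n) + \<epsilon> / 2 * real n powr (- \<gamma>))"
      by (intro s(2)) simp
    \<comment> \<open>The ratio of the end of a block to its start tends to 1 because
      \<open>chi < 1\<close>; the extra 1 is the rounding in \<open>block_length\<close>.\<close>
    have "((\<lambda>n. (1 + (real n powr chi + 1) / real n) powr \<gamma>) \<longlongrightarrow> 1) sequentially"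
    proof -
      have "(\<lambda>n. 1 + (real n powr chi + 1) / real n) \<longlonglongrightarrow> 1" using assms(1,2) by real_asymp
      from tendsto_powr[OF this tendsto_const[of \<gamma>]] show ?thesis by simp
    qed
    then have "\<forall>\<^sub>F n in sequentially. (1 + (real n powr chi + 1) / real n) powr \<gamma> < K"
      using K(1) by (rule order_tendstoD)
    with ev eventually_ge_at_top[of 1]
    show "\<forall>\<^sub>F n in sequentially. v (n + ?m n) \<le> (1 + s0) / 2 * v n + \<epsilon> \<and>
        (\<forall>j\<le>?m n. v (n + j) \<le> 2 * v n + \<epsilon>)"
    proof eventually_elim
      case (elim n)
      have n: "0 < real n powr \<gamma>" using elim(2) by simp
      have grow: "real (n + j) powr \<gamma> \<le> K * real n powr \<gamma>" if "j \<le> ?m n" for j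
      proof -
        have "real (n + j) \<le> real n + (real n powr chi + 1)"
          using that block_length_bounds(2)[where n = n and chi = chi] by simp
        also have "\<dots> = (1 + (real n powr chi + 1) / real n) * real n"
          using elim(2) by (subst distrib_right) simp
        finally have "real (n + j) \<le> (1 + (real n powr chi + 1) / real n) * real n" .
        then have "real (n + j) powr \<gamma> \<le> ((1 + (real n powr chi + 1) / real n) * real n) powr \<gamma>"
          using assms(6) by (intro powr_mono2) auto
        also have "\<dots> = (1 + (real n powr chi + 1) / real n) powr \<gamma> * real n powr \<gamma>"
          by (intro powr_mult)
        also have "\<dots> \<le> K * real n powr \<gamma>" using elim(3) by (intro mult_right_mono) auto
        finally show ?thesis .
      qed
      \<comment> \<open>Used with \<open>u = s0\<close> at the end of the block and with
        \<open>u = 1\<close> inside it.\<close>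
      have vj: "v (n + j) \<le> K * (u * v n + \<epsilon> / 2)"
        if "j \<le> ?m n" "norm (e (n + j)) \<le> u * norm (e n) + \<epsilon> / 2 * real n powr (- \<gamma>)" for j u
      proof -
        have "v (n + j) \<le> (K * real n powr \<gamma>) * (u * norm (e n) + \<epsilon> / 2 * real n powr (- \<gamma>))"
          unfolding v_def using K by (intro mult_mono grow that) auto
        also have "\<dots> = K * (u * v n + \<epsilon> / 2)"
          using n by (simp add: v_def powr_minus field_simps)
        finally show ?thesis .
      qed
      have v0: "0 \<le> v n" by (simp add: v_def)
      have K\<epsilon>: "K * (\<epsilon> / 2) \<le> \<epsilon>" using K \<open>0 < \<epsilon>\<close> by (simp add: field_simps)
      have "s * norm (e n) \<le> s0 * norm (e n)" using s0 by (intro mult_right_mono) auto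
      then have "v (n + ?m n) \<le> K * (s0 * v n + \<epsilon> / 2)"
        using elim(1) by (intro vj) auto
      also have "\<dots> = (K * s0) * v n + K * (\<epsilon> / 2)" by (simp add: algebra_simps)
      also have "\<dots> \<le> (1 + s0) / 2 * v n + \<epsilon>"
        by (intro add_mono mult_right_mono Ks v0 K\<epsilon>)
      finally have "v (n + ?m n) \<le> (1 + s0) / 2 * v n + \<epsilon>" .
      moreover have "v (n + j) \<le> 2 * v n + \<epsilon>" if "j \<le> ?m n" for j
      proof -
        have "v (n + j) \<le> K * (1 * v n + \<epsilon> / 2)" using elim(1) that by (intro vj) auto
        also have "\<dots> = K * v n + K * (\<epsilon> / 2)" by (simp add: algebra_simps)
        also have "\<dots> \<le> 2 * v n + \<epsilon>" by (intro add_mono mult_right_mono K v0 K\<epsilon>)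
        finally show ?thesis .
      qed
      ultimately show ?case by blast
    qed
  qed (use s0 in \<open>auto simp: v_def block_length_def\<close>)
  show ?thesis
  proof (rule smalloI_tendsto)
    have "\<forall>\<^sub>F n in sequentially. v n = norm (hbar n - h) / real n powr (- \<gamma>)"
      using eventually_ge_at_top[of 1]
      by eventually_elim (simp add: v_def e_def powr_minus field_simps)
    with \<open>v \<longlonglongrightarrow> 0\<close> show "(\<lambda>n. norm (hbar n - h) / real n powr (- \<gamma>)) \<longlonglongrightarrow> 0"
      by (rule Lim_transform_eventually)
    \<comment> \<open>Index 0 is left out because \<open>0 powr (- \<gamma>)\<close> is 0.\<close>
    show "\<forall>\<^sub>F n in sequentially. real n powr (- \<gamma>) \<noteq> 0"
      using eventually_ge_at_top[of 1] by eventually_elim simp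
  qed
qed

end
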